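(* Let $\mathbb{T}$ be the set of computation trees of depth $L$ of a graph $\mathcal{G}$, let $k$ be a positive integer, let $b$ be a budget with $1\le b\le|\mathbb{T}|$, and let $\Pi(\mathbb{A})$ denote the representative power of a set $\mathbb{A}\subseteq\mathbb{T}$. Let $\mathbb{A}_{greedy}$ with $|\mathbb{A}_{greedy}|=b$ be the output of the greedy algorithm: start with $\mathbb{A}=\emptyset$ and, $b$ times, pick $\mathcal{T}^*\in\arg\max_{\mathcal{T}\in\mathbb{T}\setminus\mathbb{A}}\{\Pi(\mathbb{A}\cup\{\mathcal{T}\})-\Pi(\mathbb{A})\}$ and replace $\mathbb{A}$ by $\mathbb{A}\cup\{\mathcal{T}^*\}$. Let $\mathbb{A}^*\in\arg\max_{\mathbb{A}\subseteq\mathbb{T},\,|\mathbb{A}|=b}\Pi(\mathbb{A})$. Then $$\Pi(\mathbb{A}_{greedy})\ge\left(1-\frac1e\right)\Pi(\mathbb{A}^* ).$$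
   Context: A graph $\mathcal{G}=(\mathcal{V},\mathcal{E},\boldsymbol{X})$ has a finite non-empty node set $\mathcal{V}$, edge set $\mathcal{E}$, and a real feature vector $\mathbf{x}_v$ for each node $v$. For an integer $L\ge 1$, the computation tree $\mathcal{T}_v^L$ rooted at $v$ is obtained by enumerating all paths of length $L$ starting at $v$ (repeated vertices allowed) and merging them into a tree rooted at $v$, where occurrences of the same node on different paths are merged if they are at the same depth and all their ancestors are already merged. $\mathbb{T}=\{\mathcal{T}_v^L \mid v\in\mathcal{V}\}$ is regarded as a multiset indexed by nodes, so $|\mathbb{T}|=|\mathcal{V}|$. WL-embeddings: $\mathbf{a}_v^0=\mathbf{x}_v$ and $\mathbf{a}_v^{\ell}=\frac12\left(\mathbf{a}_v^{\ell-1}+\frac{1}{\deg(v)}\sum_{u\in\mathcal{N}(v)}w((v,u))\,\mathbf{a}_u^{\ell-1}\right)$, where $\mathcal{N}(v)$ is the set of neighbors of $v$, $\deg(v)=|\mathcal{N}(v)|$ and $w$ are edge weights ($w=1$ for unweighted graphs). The distance between computation trees is $d(\mathcal{T}_v^L,\mathcal{T}_u^L)=\|\mathbf{a}_v^L-\mathbf{a}_u^L\|_2$. $k\text{-NN}(\mathcal{T}_u^L)$ is the set of the $k$ nearest computation trees from $\mathbb{T}$ to $\mathcal{T}_u^L$ with respect to $d$. Reverse $k$-NN: $\text{Rev-}k\text{-NN}(\mathcal{T}_v^L)=\{\mathcal{T}_u^L\in\mathbb{T}\mid \mathcal{T}_v^L\in k\text{-NN}(\mathcal{T}_u^L)\}$.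 The representative power of a set $\mathbb{A}\subseteq\mathbb{T}$ is $$\Pi(\mathbb{A})=\left|\bigcup_{\mathcal{T}_v^L\in\mathbb{A}}\text{Rev-}k\text{-NN}(\mathcal{T}_v^L)\right|\Big/|\mathbb{T}|.$$ *)

theory Defs
  imports
    "HOL-Analysis.Analysis"
    "HOL-Library.Sublist"
    "Graph_Theory.Pair_Digraph"
    "Graph_Theory.Vertex_Walk"
begin

text \<open>
  Edges are ordered pairs (undirected graphs are the symmetric ones), node features are given by a
  map \<open>X\<close> and edge weights by a map \<open>w\<close> (constantly \<open>1\<close> for unweighted graphs).
\<close>

definition neighbors :: "'v pair_pre_digraph \<Rightarrow> 'v \<Rightarrow> 'v set" where
  "neighbors G v = {u. (v, u) \<in> parcs G}"

definition deg :: "'v pair_pre_digraph \<Rightarrow> 'v \<Rightarrow> nat" where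
  "deg G v = card (neighbors G v)"

text \<open>If \<open>v\<close> has no neighbors, the inner sum is empty and the second summand vanishes.\<close>

primrec wl_embedding ::
  "'v pair_pre_digraph \<Rightarrow> ('v \<Rightarrow> real ^ 'd) \<Rightarrow> ('v \<times> 'v \<Rightarrow> real) \<Rightarrow> nat \<Rightarrow> 'v \<Rightarrow> real ^ 'd" where
  "wl_embedding G X w 0 v = X v"
| "wl_embedding G X w (Suc l) v =
     (1 / 2) *\<^sub>R (wl_embedding G X w l v
       + (1 / real (deg G v)) *\<^sub>R (\<Sum>u\<in>neighbors G v. w (v, u) *\<^sub>R wl_embedding G X w l u))"

definition paths_from :: "'v pair_pre_digraph \<Rightarrow> nat \<Rightarrow> 'v \<Rightarrow> 'v list set" where
  "paths_from G L v = {p. vwalk p G \<and> hd p = v \<and> vwalk_length p = L}"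

text \<open>
  Two positions on paths starting at the same root are merged iff they have the same depth and
  agree in their node and in all their ancestors, i.e. iff the paths have the same prefix up to
  these positions. Hence the vertices of the merged tree are the nonempty prefixes of the paths;
  such a prefix is an occurrence of its last node, at depth its length minus one. The root \<open>[v]\<close> is
  added explicitly since there may be no path of length \<open>L\<close> starting at \<open>v\<close>.
\<close>

record 'v computation_tree = "'v list pair_pre_digraph" +
  troot :: "'v list"

definition tree_nodes :: "'v pair_pre_digraph \<Rightarrow> nat \<Rightarrow> 'v \<Rightarrow> 'v list set" where
  "tree_nodes G L v = insert [v] {q. q \<noteq> [] \<and> (\<exists>p\<in>paths_from G L v. prefix q p)}"

definition computation_tree :: "'v pair_pre_digraph \<Rightarrow> nat \<Rightarrow> 'v \<Rightarrow> 'v computation_tree" where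
  "computation_tree G L v =
     \<lparr> pverts = tree_nodes G L v,
       parcs = {(p, q). p \<in> tree_nodes G L v \<and> q \<in> tree_nodes G L v \<and> (\<exists>u. q = p @ [u])},
       troot = [v] \<rparr>"

text \<open>
  Occurrences remember the graph node they stem from, so different nodes have different computation
  trees. The set below therefore is the multiset of computation trees indexed by the nodes.
\<close>

definition computation_trees :: "'v pair_pre_digraph \<Rightarrow> nat \<Rightarrow> 'v computation_tree set" where
  "computation_trees G L = computation_tree G L ` pverts G"

definition root_node :: "'v computation_tree \<Rightarrow> 'v" where
  "root_node T = last (troot T)"

lemma root_node_computation_tree [simp]: "root_node (computation_tree G L v) = v"
  by (simp add: root_node_def computation_tree_def)

lemma inj_computation_tree: "inj (computation_tree G L)"
  by (metis injI root_node_computation_tree)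

lemma card_computation_trees: "card (computation_trees G L) = card (pverts G)"
  unfolding computation_trees_def
  by (rule card_image) (rule inj_on_subset[OF inj_computation_tree subset_UNIV])

definition tree_dist ::
  "'v pair_pre_digraph \<Rightarrow> ('v \<Rightarrow> real ^ 'd) \<Rightarrow> ('v \<times> 'v \<Rightarrow> real) \<Rightarrow> nat
     \<Rightarrow> 'v computation_tree \<Rightarrow> 'v computation_tree \<Rightarrow> real" where
  "tree_dist G X w L S T =
     norm (wl_embedding G X w L (root_node S) - wl_embedding G X w L (root_node T))"

lemma tree_dist_computation_tree:
  "tree_dist G X w L (computation_tree G L v) (computation_tree G L u) =
     norm (wl_embedding G X w L v - wl_embedding G X w L u)"
  by (simp add: tree_dist_def)

text \<open>
  \<open>K\<close> is a set of \<open>k\<close> nearest elements of \<open>TT\<close> to \<open>T\<close>. As distances may tie, such a set need not be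
  unique. \<open>T\<close> itself is a candidate, and all of \<open>TT\<close> is taken if it has fewer than \<open>k\<close> elements.
\<close>

definition is_kNN :: "('t \<Rightarrow> 't \<Rightarrow> real) \<Rightarrow> 't set \<Rightarrow> nat \<Rightarrow> 't \<Rightarrow> 't set \<Rightarrow> bool" where
  "is_kNN d TT k T K \<longleftrightarrow>
     K \<subseteq> TT \<and> card K = min k (card TT) \<and> (\<forall>S\<in>K. \<forall>S'\<in>TT - K. d S T \<le> d S' T)"

definition rev_kNN :: "'t set \<Rightarrow> ('t \<Rightarrow> 't set) \<Rightarrow> 't \<Rightarrow> 't set" where
  "rev_kNN TT kNN T = {U \<in> TT. T \<in> kNN U}"

definition rep_power :: "'t set \<Rightarrow> ('t \<Rightarrow> 't set) \<Rightarrow> 't set \<Rightarrow> real" where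
  "rep_power TT kNN A = real (card (\<Union>T\<in>A. rev_kNN TT kNN T)) / real (card TT)"

text \<open>
  \<open>greedy_output P TT n A\<close>: \<open>A\<close> is a possible result of \<open>n\<close> greedy steps for the objective \<open>P\<close> over
  the ground set \<open>TT\<close>, with ties between best elements broken arbitrarily.
\<close>

inductive greedy_output :: "('t set \<Rightarrow> real) \<Rightarrow> 't set \<Rightarrow> nat \<Rightarrow> 't set \<Rightarrow> bool"
  for P :: "'t set \<Rightarrow> real" and TT :: "'t set" where
  empty: "greedy_output P TT 0 {}"
| step: "greedy_output P TT n A \<Longrightarrow>
    is_arg_max (\<lambda>T. P (A \<union> {T}) - P A) (\<lambda>T. T \<in> TT - A) T \<Longrightarrow>
    greedy_output P TT (Suc n) (A \<union> {T})"

end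

theory Submission
  imports Defs
begin

text \<open>
  The representative power is a normalized coverage function, hence monotone and submodular, and the
  bound is that of Nemhauser, Wolsey and Fisher for such functions: by submodularity some element
  of an optimal set gains at least a \<open>1/b\<close> fraction of the current gap to the optimum, so each greedy
  step shrinks the gap by the factor \<open>1 - 1/b\<close>, and \<open>(1 - 1/b)\<^sup>b \<le> 1/e\<close>.
\<close>

definition monotone_set_fun :: "('t set \<Rightarrow> real) \<Rightarrow> 't set \<Rightarrow> bool" where
  "monotone_set_fun P TT \<longleftrightarrow> (\<forall>A B. A \<subseteq> B \<longrightarrow> B \<subseteq> TT \<longrightarrow> P A \<le> P B)"

definition submodular :: "('t set \<Rightarrow> real) \<Rightarrow> 't set \<Rightarrow> bool" where
  "submodular P TT \<longleftrightarrow> (\<forall>A B T. A \<subseteq> B \<longrightarrow> B \<subseteq> TT \<longrightarrow> T \<in> TT - B \<longrightarrow>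
     P (B \<union> {T}) - P B \<le> P (A \<union> {T}) - P A)"

lemma monotone_set_funD:
  "monotone_set_fun P TT \<Longrightarrow> A \<subseteq> B \<Longrightarrow> B \<subseteq> TT \<Longrightarrow> P A \<le> P B"
  by (simp add: monotone_set_fun_def)

lemma submodularD:
  "submodular P TT \<Longrightarrow> A \<subseteq> B \<Longrightarrow> B \<subseteq> TT \<Longrightarrow> T \<in> TT - B \<Longrightarrow>
    P (B \<union> {T}) - P B \<le> P (A \<union> {T}) - P A"
  by (simp add: submodular_def)

text \<open>Adding the elements of \<open>S\<close> to \<open>A\<close> one by one, each increment
  is taken over a superset of \<open>A\<close>, so diminishing returns bound it by the gain over
  \<open>A\<close> itself.\<close>

lemma submodular_union_le:
  assumes mono: "monotone_set_fun P TT" and sub: "submodular P TT"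
    and "finite S" "S \<subseteq> TT" "A \<subseteq> TT"
  shows "P (A \<union> S) \<le> P A + (\<Sum>T\<in>S. P (A \<union> {T}) - P A)"
  using \<open>finite S\<close> \<open>S \<subseteq> TT\<close>
proof (induction S rule: finite_induct)
  case empty
  then show ?case by simp
next
  case (insert T S)
  have "P (A \<union> S \<union> {T}) - P (A \<union> S) \<le> P (A \<union> {T}) - P A"
  \<comment> \<open>The new element is outside \<open>S\<close> but may lie in \<open>A\<close>,
    where submodularity says nothing; there the left side is 0 and monotonicity makes the right side
    nonnegative.\<close>
  proof (cases "T \<in> A \<union> S")
    case True
    then have "A \<union> S \<union> {T} = A \<union> S" by blast
    moreover have "P A \<le> P (A \<union> {T})"
      using insert.prems \<open>A \<subseteq> TT\<close> by (intro monotone_set_funD[OF mono]) auto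
    ultimately show ?thesis by simp
  next
    case False
    then show ?thesis
      using insert.prems \<open>A \<subseteq> TT\<close> by (intro submodularD[OF sub]) auto
  qed
  then show ?case
    using insert by simp
qed

text \<open>The gap to \<open>P S\<close> is at most the sum of the single-element gains over
  \<open>S\<close>, and the greedy choice dominates each summand.\<close>

lemma greedy_step_gain:
  assumes mono: "monotone_set_fun P TT" and sub: "submodular P TT"
    and "finite S" "S \<subseteq> TT" "A \<subseteq> TT"
    and T: "is_arg_max (\<lambda>T. P (A \<union> {T}) - P A) (\<lambda>T. T \<in> TT - A) T"
  shows "P S - P A \<le> real (card S) * (P (A \<union> {T}) - P A)"
proof -
  have "T \<in> TT"
    using T by (simp add: is_arg_max_def)
  then have nonneg: "0 \<le> P (A \<union> {T}) - P A"
    using monotone_set_funD[OF mono, of A "A \<union> {T}"] \<open>A \<subseteq> TT\<close> by auto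
  \<comment> \<open>Elements of \<open>S\<close> already in \<open>A\<close> do not compete in the
    arg max, but they gain 0.\<close>
  have gain: "P (A \<union> {U}) - P A \<le> P (A \<union> {T}) - P A" if "U \<in> S" for U
  proof (cases "U \<in> A")
    case True
    then show ?thesis using nonneg by (simp add: insert_absorb)
  next
    case False
    then show ?thesis
      using T that \<open>S \<subseteq> TT\<close> unfolding is_arg_max_def by (meson DiffI not_le subsetD)
  qed
  have "P S \<le> P (A \<union> S)"
    using \<open>S \<subseteq> TT\<close> \<open>A \<subseteq> TT\<close> by (intro monotone_set_funD[OF mono]) auto
  also have "\<dots> \<le> P A + (\<Sum>U\<in>S. P (A \<union> {U}) - P A)"
    by (rule submodular_union_le[OF mono sub assms(3-5)])
  also have "(\<Sum>U\<in>S. P (A \<union> {U}) - P A) \<le> real (card S) * (P (A \<union> {T}) - P A)"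
    using gain by (rule sum_bounded_above)
  finally show ?thesis by simp
qed

lemma greedy_output_subset: "greedy_output P TT n A \<Longrightarrow> A \<subseteq> TT"
  by (induction rule: greedy_output.induct) (auto simp: is_arg_max_def)

text \<open>The number of steps \<open>n\<close> is kept independent of \<open>card S\<close>, so
  that induction on the greedy run is possible with a fixed contraction factor.\<close>

lemma greedy_output_gap:
  assumes "monotone_set_fun P TT" "submodular P TT"
    and "finite S" "S \<subseteq> TT" "S \<noteq> {}"
    and "greedy_output P TT n A"
  shows "P S - P A \<le> (1 - 1 / real (card S)) ^ n * (P S - P {})"
  using \<open>greedy_output P TT n A\<close>
proof (induction rule: greedy_output.induct)
  case empty
  then show ?case by simp
next
  case (step n A T)
  define c where "c = real (card S)"
  have c: "c \<ge> 1"
    using assms(3,5) by (simp add: c_def Suc_le_eq card_gt_0_iff)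
  have "P S - P A \<le> c * (P (A \<union> {T}) - P A)"
    unfolding c_def
    by (rule greedy_step_gain[OF assms(1-4) greedy_output_subset[OF step.hyps(1)] step.hyps(2)])
  then have "(P S - P A) / c \<le> P (A \<union> {T}) - P A"
    using c by (simp add: field_simps)
  \<comment> \<open>The new gap is the old gap minus the gain, and the gain is at least a 1/c share
    of the old gap.\<close>
  then have "P S - P (A \<union> {T}) \<le> (1 - 1 / c) * (P S - P A)"
    by (simp add: algebra_simps diff_divide_distrib)
  also have "\<dots> \<le> (1 - 1 / c) * ((1 - 1 / c) ^ n * (P S - P {}))"
    \<comment> \<open>Here \<open>c \<ge> 1\<close> makes the factor nonnegative.\<close>
    using step.IH c by (intro mult_left_mono) (simp_all add: c_def)
  finally show ?case by (simp add: c_def)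
qed

text \<open>This is 1 + x \<le> exp x at x = -1/n, raised to the n-th power; the base is nonnegative
  since n \<ge> 1.\<close>

lemma one_minus_inverse_power_le: "(1 - 1 / real n) ^ n \<le> 1 / exp 1" if "n \<ge> 1"
proof -
  have "(1 - 1 / real n) ^ n \<le> exp (- (1 / real n)) ^ n"
    using exp_ge_add_one_self[of "- (1 / real n)"] that by (intro power_mono) simp_all
  also have "\<dots> = 1 / exp 1"
    using that by (simp add: exp_of_nat_mult[symmetric] exp_minus_inverse flip: inverse_eq_divide exp_minus)
  finally show ?thesis .
qed

theorem greedy_output_approximation:
  assumes mono: "monotone_set_fun P TT" and sub: "submodular P TT" and "P {} \<ge> 0"
    and "finite S" "S \<subseteq> TT" "S \<noteq> {}"
    and greedy: "greedy_output P TT (card S) A"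
  shows "P A \<ge> (1 - 1 / exp 1) * P S"
proof -
  have "card S \<ge> 1"
    using assms by (simp add: Suc_le_eq card_gt_0_iff)
  have le: "P {} \<le> P S"
    using \<open>S \<subseteq> TT\<close> by (intro monotone_set_funD[OF mono]) auto
  have "P S - P A \<le> (1 - 1 / real (card S)) ^ card S * (P S - P {})"
    by (rule greedy_output_gap[OF mono sub assms(4-7)])
  also have "\<dots> \<le> 1 / exp 1 * (P S - P {})"
    using one_minus_inverse_power_le[OF \<open>card S \<ge> 1\<close>] le by (intro mult_right_mono) simp_all
  \<comment> \<open>Since \<open>P\<close> need not vanish on the empty set, its nonnegativity there
    is what turns the bound on the gap into a multiplicative one.\<close>
  also have "\<dots> \<le> 1 / exp 1 * P S"
    using \<open>P {} \<ge> 0\<close> by (intro mult_left_mono) simp_all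
  finally show ?thesis by (simp add: algebra_simps)
qed

lemma finite_rev_kNN: "finite TT \<Longrightarrow> finite (rev_kNN TT kNN T)"
  by (simp add: rev_kNN_def)

lemma finite_Union_rev_kNN: "finite TT \<Longrightarrow> finite (\<Union>T\<in>A. rev_kNN TT kNN T)"
  by (rule finite_subset[of _ TT]) (auto simp: rev_kNN_def)

lemma monotone_rep_power: "finite TT \<Longrightarrow> monotone_set_fun (rep_power TT kNN) TT"
  unfolding monotone_set_fun_def rep_power_def
  by (intro allI impI divide_right_mono of_nat_mono card_mono finite_Union_rev_kNN) auto

text \<open>The union grows exactly by the part of the new reverse neighborhood that is not yet
  covered.\<close>

lemma rep_power_gain:
  assumes "finite TT"
  shows "rep_power TT kNN (A \<union> {T}) - rep_power TT kNN A =
    real (card (rev_kNN TT kNN T - (\<Union>U\<in>A. rev_kNN TT kNN U))) / real (card TT)"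
proof -
  let ?r = "rev_kNN TT kNN" and ?C = "\<Union>U\<in>A. rev_kNN TT kNN U"
  have "(\<Union>U\<in>A \<union> {T}. ?r U) = ?C \<union> (?r T - ?C)" by blast
  then have "card (\<Union>U\<in>A \<union> {T}. ?r U) = card ?C + card (?r T - ?C)"
    using finite_rev_kNN[OF assms] finite_Union_rev_kNN[OF assms]
    by (metis card_Un_disjoint Diff_disjoint finite_Diff)
  then show ?thesis
    unfolding rep_power_def by (simp add: add_divide_distrib)
qed

text \<open>A larger set covers more, so it leaves fewer trees for \<open>T\<close> to cover
  anew.\<close>

lemma submodular_rep_power:
  assumes "finite TT"
  shows "submodular (rep_power TT kNN) TT"
  unfolding submodular_def rep_power_gain[OF assms]
  by (intro allI impI divide_right_mono of_nat_mono card_mono finite_Diff finite_rev_kNN assms) auto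

theorem theorem2:
  fixes G :: "'v pair_pre_digraph"
    and X :: "'v \<Rightarrow> real ^ 'd"
    and w :: "'v \<times> 'v \<Rightarrow> real"
    and L k b :: nat
    and kNN :: "'v computation_tree \<Rightarrow> 'v computation_tree set"
    and A_greedy A_star :: "'v computation_tree set"
  defines "TT \<equiv> computation_trees G L"
  defines "Pi_rep \<equiv> rep_power TT kNN"
  assumes "pair_fin_digraph G" and "pverts G \<noteq> {}"
    and "L \<ge> 1" and "k \<ge> 1"
    and "\<And>T. T \<in> TT \<Longrightarrow> is_kNN (tree_dist G X w L) TT k T (kNN T)"
    and "1 \<le> b" and "b \<le> card TT"
    and "greedy_output Pi_rep TT b A_greedy"
    and "is_arg_max Pi_rep (\<lambda>A. A \<subseteq> TT \<and> card A = b) A_star"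
  shows "Pi_rep A_greedy \<ge> (1 - 1 / exp 1) * Pi_rep A_star"
proof -
  have "finite TT"
    using pair_fin_digraph.pair_finite_verts[OF assms(3)]
    by (simp add: TT_def computation_trees_def)
  have star: "A_star \<subseteq> TT" "card A_star = b"
    using assms(11) by (simp_all add: is_arg_max_def)
  \<comment> \<open>The optimal set serves as \<open>S\<close>, so its size \<open>b\<close> is both
    the number of greedy steps and the divisor in the contraction factor.\<close>
  have "A_star \<noteq> {}"
    using star(2) \<open>1 \<le> b\<close> by auto
  moreover have "Pi_rep {} \<ge> 0"
    by (simp add: Pi_rep_def rep_power_def)
  ultimately show ?thesis
    using greedy_output_approximation[of Pi_rep TT A_star A_greedy]
      monotone_rep_power[OF \<open>finite TT\<close>] submodular_rep_power[OF \<open>finite TT\<close>]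
      star assms(10) finite_subset[OF star(1) \<open>finite TT\<close>]
    by (simp add: Pi_rep_def)
qed

end
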